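(* For $Q\in\mathrm{Gr}(k,n)$ with $Q=VI_{k,n-k}V^{\mathsf T}$, $V\in\mathrm{O}(n)$, and tangent vectors \[ X=V\begin{bmatrix}0 & B \\ B^{\mathsf T} & 0\end{bmatrix}V^{\mathsf T},\qquad Y=V\begin{bmatrix}0 & C \\ C^{\mathsf T} & 0\end{bmatrix}V^{\mathsf T}\in\mathbb{T}_Q\mathrm{Gr}(k,n), \] where $B,C\in\mathbb{R}^{k\times(n-k)}$, the expression \[ \langle X,Y\rangle_Q:=\operatorname{tr}(XY)=2\operatorname{tr}(B^{\mathsf T}C) \] defines a Riemannian metric on $\mathrm{Gr}(k,n)$. The corresponding Riemannian norm is $\|X\|_Q=\sqrt{\langle X,X\rangle_Q}=\|X\|_{\mathsf F}=\sqrt2\,\|B\|_{\mathsf F}$.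
   Context: For $k\in\{1,\dots,n\}$, $\mathrm{Gr}(k,n)=\{Q\in\mathrm{O}(n):Q^{\mathsf T}=Q,\ \operatorname{tr}(Q)=2k-n\}$, an embedded submanifold of $\mathbb{R}^{n\times n}$. $I_{k,n-k}=\operatorname{diag}(I_k,-I_{n-k})$. Every $Q\in\mathrm{Gr}(k,n)$ can be written $Q=VI_{k,n-k}V^{\mathsf T}$ with $V\in\mathrm{O}(n)$, and $\mathbb{T}_Q\mathrm{Gr}(k,n)=\bigl\{V\begin{bmatrix}0 & B \\ B^{\mathsf T} & 0\end{bmatrix}V^{\mathsf T}:B\in\mathbb{R}^{k\times(n-k)}\bigr\}$. $\|\cdot\|_{\mathsf F}$ is the Frobenius norm. *)

theory Defs
  imports "HOL-Analysis.Analysis" "Jordan_Normal_Form.Matrix"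
begin

text \<open>\<open>C\<^sup>m\<close> on a set that is meant to be open: all iterated directional derivatives
  up to order \<open>m\<close> exist as total derivatives and are continuous.\<close>

fun C_diff_on :: "nat \<Rightarrow> 'a::euclidean_space set \<Rightarrow> ('a \<Rightarrow> 'b::real_normed_vector) \<Rightarrow> bool" where
  "C_diff_on 0 U f \<longleftrightarrow> continuous_on U f"
| "C_diff_on (Suc m) U f \<longleftrightarrow>
     (\<forall>x\<in>U. f differentiable (at x)) \<and>
     (\<forall>v. C_diff_on m U (\<lambda>x. frechet_derivative f (at x) v))"

definition smooth_on :: "'a::euclidean_space set \<Rightarrow> ('a \<Rightarrow> 'b::real_normed_vector) \<Rightarrow> bool" where
  "smooth_on U f \<longleftrightarrow> open U \<and> (\<forall>m. C_diff_on m U f)"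

text \<open>\<open>M\<close> is a \<open>d\<close>-dimensional embedded submanifold if near each of its points it is the zero
  set of a smooth submersion \<open>h\<close> onto a space \<open>W\<close> of dimension \<open>DIM('a) - d\<close>. Since that
  dimension is at most \<open>DIM('a)\<close>, taking \<open>W\<close> to be a subspace of \<open>'a\<close> itself loses nothing.\<close>

definition embedded_submanifold :: "nat \<Rightarrow> 'a::euclidean_space set \<Rightarrow> bool" where
  "embedded_submanifold d M \<longleftrightarrow>
     (\<forall>x\<in>M. \<exists>U W (h :: 'a \<Rightarrow> 'a).
        x \<in> U \<and> smooth_on U h \<and> subspace W \<and> dim W + d = DIM('a) \<and> h ` U \<subseteq> W \<and>
        range (frechet_derivative h (at x)) = W \<and>
        M \<inter> U = {y \<in> U. h y = 0})"

definition tangent_space :: "'a::euclidean_space set \<Rightarrow> 'a \<Rightarrow> 'a set" where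
  "tangent_space M x =
     {v. \<exists>\<epsilon>>0. \<exists>c :: real \<Rightarrow> 'a.
        smooth_on {-\<epsilon><..<\<epsilon>} c \<and> c ` {-\<epsilon><..<\<epsilon>} \<subseteq> M \<and> c 0 = x \<and>
        (c has_vector_derivative v) (at 0)}"

definition smooth_map_on ::
    "'a::euclidean_space set \<Rightarrow> ('a \<Rightarrow> 'b::real_normed_vector) \<Rightarrow> bool" where
  "smooth_map_on M f \<longleftrightarrow>
     (\<forall>x\<in>M. \<exists>U F. x \<in> U \<and> smooth_on U F \<and> (\<forall>y\<in>M \<inter> U. F y = f y))"

definition smooth_vector_field :: "'a::euclidean_space set \<Rightarrow> ('a \<Rightarrow> 'a) \<Rightarrow> bool" where
  "smooth_vector_field M X \<longleftrightarrow>
     (\<forall>x\<in>M. X x \<in> tangent_space M x) \<and> smooth_map_on M X"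

text \<open>Linearity in the second argument follows from symmetry.\<close>

definition inner_product_on :: "'a::real_vector set \<Rightarrow> ('a \<Rightarrow> 'a \<Rightarrow> real) \<Rightarrow> bool" where
  "inner_product_on S f \<longleftrightarrow> subspace S \<and>
     (\<forall>u\<in>S. \<forall>v\<in>S. f u v = f v u) \<and>
     (\<forall>u\<in>S. \<forall>v\<in>S. \<forall>w\<in>S. \<forall>a b. f (a *\<^sub>R u + b *\<^sub>R v) w = a * f u w + b * f v w) \<and>
     (\<forall>u\<in>S. u \<noteq> 0 \<longrightarrow> f u u > 0)"

definition riemannian_metric ::
    "'a::euclidean_space set \<Rightarrow> ('a \<Rightarrow> 'a \<Rightarrow> 'a \<Rightarrow> real) \<Rightarrow> bool" where
  "riemannian_metric M g \<longleftrightarrow>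
     (\<exists>d. embedded_submanifold d M) \<and>
     (\<forall>x\<in>M. inner_product_on (tangent_space M x) (g x)) \<and>
     (\<forall>X Y. smooth_vector_field M X \<and> smooth_vector_field M Y \<longrightarrow>
        smooth_map_on M (\<lambda>x. g x (X x) (Y x)))"

definition riemannian_norm :: "('a \<Rightarrow> 'a \<Rightarrow> 'a \<Rightarrow> real) \<Rightarrow> 'a \<Rightarrow> 'a \<Rightarrow> real" where
  "riemannian_norm g x u = sqrt (g x u u)"

definition Gr :: "nat \<Rightarrow> (real^'n^'n) set" where
  "Gr k = {Q. orthogonal_matrix Q \<and> transpose Q = Q \<and>
              trace Q = 2 * real k - real CARD('n)}"

definition gr_metric :: "real^'n^'n \<Rightarrow> real^'n^'n \<Rightarrow> real^'n^'n \<Rightarrow> real" where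
  "gr_metric Q X Y = trace (X ** Y)"

text \<open>Block matrices have blocks of size depending on \<open>k\<close>, possibly with no columns (\<open>k = n\<close>),
  so they are matrices with explicit dimensions. An enumeration \<open>e\<close> of the index type \<open>'n\<close> by
  \<open>0, \<dots>, n - 1\<close> turns an \<open>n \<times> n\<close> matrix of that kind into an element of \<open>real^'n^'n\<close>.\<close>

definition to_hma :: "('n \<Rightarrow> nat) \<Rightarrow> real mat \<Rightarrow> real^'n^'n" where
  "to_hma e A = (\<chi> i j. A $$ (e i, e j))"

definition signature_mat :: "nat \<Rightarrow> nat \<Rightarrow> real mat" where
  "signature_mat k m = four_block_mat (1\<^sub>m k) (0\<^sub>m k m) (0\<^sub>m m k) (- 1\<^sub>m m)"

definition offdiag_mat :: "real mat \<Rightarrow> real mat" where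
  "offdiag_mat B =
     four_block_mat (0\<^sub>m (dim_row B) (dim_row B)) B
                    (transpose_mat B) (0\<^sub>m (dim_col B) (dim_col B))"

definition mat_trace :: "real mat \<Rightarrow> real" where
  "mat_trace A = (\<Sum>i<dim_row A. A $$ (i, i))"

definition mat_frobenius :: "real mat \<Rightarrow> real" where
  "mat_frobenius A = sqrt (\<Sum>i<dim_row A. \<Sum>j<dim_col A. (A $$ (i, j))\<^sup>2)"

definition frobenius :: "real^'n^'m \<Rightarrow> real" where
  "frobenius A = sqrt (\<Sum>i\<in>UNIV. \<Sum>j\<in>UNIV. (vec_nth (vec_nth A i) j)\<^sup>2)"

end

theory Submission
  imports Defs
begin

text \<open>Near \<open>Q \<in> Gr k\<close> the Grassmannian is the zero set of the map sending \<open>Y\<close>, with symmetric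
  part \<open>S\<close>, to the sum of the skew part of \<open>Y\<close> and the component of \<open>S\<^sup>2 - 1\<close> commuting with
  \<open>Q\<close>. Indeed if \<open>E = S\<^sup>2 - 1\<close> anticommutes with \<open>Q\<close>, then, since \<open>E\<close> commutes with \<open>S\<close>,
  \<open>2QE = E(S - Q) - (S - Q)E\<close>, which forces \<open>E = 0\<close> for \<open>S\<close> close to \<open>Q\<close>; and then \<open>1 + SQ\<close> is
  invertible and conjugates \<open>Q\<close> into \<open>S\<close>, so that their traces agree. The normal space has the same
  dimension at every \<open>Q\<close>, because the trace of the orthogonal projection onto it depends only
  on \<open>n\<close> and \<open>tr Q\<close>. The tangent space at \<open>Q\<close> consists of the symmetric matrices anticommuting with
  \<open>Q\<close>; Cayley transforms provide curves realizing all of them.\<close>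

no_notation vec_index (infixl \<open>$\<close> 100)
no_notation scalar_prod (infix \<open>\<bullet>\<close> 70)
hide_const (open) Matrix.mat

section \<open>Smooth maps\<close>

text \<open>On an open set the Frechet derivative at a point depends only on the values in
  \<open>U\<close>, so the induction can pass to directional derivatives.\<close>

lemma C_diff_on_cong:
  assumes "C_diff_on m U f" "open U" "\<And>x. x \<in> U \<Longrightarrow> f x = g x"
  shows "C_diff_on m U g"
  using assms
proof (induction m arbitrary: f g)
  case 0
  then show ?case by (simp cong: continuous_on_cong)
next
  case (Suc m)
  have d: "f differentiable (at x)" if "x \<in> U" for x
    using Suc.prems(1) that by simp
  have d': "g differentiable (at x)" if x: "x \<in> U" for x
    using d[OF x] Suc.prems(2,3) x unfolding differentiable_def
    by (meson has_derivative_transform_within_open)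
  have "frechet_derivative f (at x) = frechet_derivative g (at x)" if "x \<in> U" for x
    using frechet_derivative_transform_within_open[OF d[OF that] Suc.prems(2) that Suc.prems(3)] .
  then have "C_diff_on m U (\<lambda>x. frechet_derivative g (at x) v)" for v
    using Suc.IH[of "\<lambda>x. frechet_derivative f (at x) v" "\<lambda>x. frechet_derivative g (at x) v"]
      Suc.prems(1,2) by simp
  with d' show ?case by simp
qed

text \<open>Lets an explicit formula \<open>f'\<close> stand in for
  \<open>frechet_derivative\<close>; the rules for sums, linear maps and products are inductions
  through it.\<close>

lemma C_diff_on_SucI:
  assumes "open U" "\<And>x. x \<in> U \<Longrightarrow> (f has_derivative f' x) (at x)"
    and "\<And>v. C_diff_on m U (\<lambda>x. f' x v)"
  shows "C_diff_on (Suc m) U f"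
proof -
  have "f' x v = frechet_derivative f (at x) v" if "x \<in> U" for x v
    using frechet_derivative_at[OF assms(2)[OF that]] by simp
  then have "C_diff_on m U (\<lambda>x. frechet_derivative f (at x) v)" for v
    using C_diff_on_cong[OF assms(3)[of v] assms(1)] by simp
  with assms(2) show ?thesis
    by (auto simp: differentiable_def)
qed

lemma C_diff_on_SucD: "C_diff_on (Suc m) U f \<Longrightarrow> C_diff_on m U f"
proof (induction m arbitrary: f)
  case 0
  then show ?case
    by (auto intro!: differentiable_imp_continuous_on
        simp: differentiable_on_def differentiable_at_withinI)
next
  case (Suc m)
  have "C_diff_on m U (\<lambda>x. frechet_derivative f (at x) v)" for v
    using Suc.prems C_diff_on.simps(2) by (intro Suc.IH) blast
  then show ?case
    using Suc.prems C_diff_on.simps(2)[of m U f] C_diff_on.simps(2)[of "Suc m" U f] by blast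
qed

lemma C_diff_on_subset: "C_diff_on m U f \<Longrightarrow> V \<subseteq> U \<Longrightarrow> C_diff_on m V f"
proof (induction m arbitrary: f)
  case 0
  then show ?case by (auto intro: continuous_on_subset)
next
  case (Suc m)
  have "C_diff_on m V (\<lambda>x. frechet_derivative f (at x) v)" for v
    using Suc.prems by (intro Suc.IH) simp_all
  then show ?case
    using Suc.prems by auto
qed

lemma C_diff_on_const: "C_diff_on m U (\<lambda>x. c)"
  by (induction m arbitrary: c) auto

lemma C_diff_on_ident: "open U \<Longrightarrow> C_diff_on m U (\<lambda>x. x)"
  by (cases m) (auto simp: C_diff_on_const)

lemma C_diff_on_add:
  assumes "open U" "C_diff_on m U f" "C_diff_on m U g"
  shows "C_diff_on m U (\<lambda>x. f x + g x)"
  using assms(2,3)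
proof (induction m arbitrary: f g)
  case 0
  then show ?case by (simp add: continuous_on_add)
next
  case (Suc m)
  show ?case
  proof (rule C_diff_on_SucI[OF assms(1)])
    show "((\<lambda>x. f x + g x) has_derivative
        (\<lambda>v. frechet_derivative f (at x) v + frechet_derivative g (at x) v)) (at x)"
      if "x \<in> U" for x
      using Suc.prems that by (auto intro!: has_derivative_add simp: frechet_derivative_works)
    show "C_diff_on m U (\<lambda>x. frechet_derivative f (at x) v + frechet_derivative g (at x) v)" for v
      using Suc by simp
  qed
qed

lemma C_diff_on_bounded_linear:
  assumes "bounded_linear L" "open U" "C_diff_on m U f"
  shows "C_diff_on m U (\<lambda>x. L (f x))"
  using assms(3)
proof (induction m arbitrary: f)
  case 0
  then show ?case using bounded_linear.continuous_on[OF assms(1)] by simp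
next
  case (Suc m)
  show ?case
  proof (rule C_diff_on_SucI[OF assms(2)])
    show "((\<lambda>x. L (f x)) has_derivative (\<lambda>v. L (frechet_derivative f (at x) v))) (at x)"
      if "x \<in> U" for x
      using Suc.prems that
      by (auto intro!: bounded_linear.has_derivative[OF assms(1)] simp: frechet_derivative_works)
    show "C_diff_on m U (\<lambda>x. L (frechet_derivative f (at x) v))" for v
      using Suc by simp
  qed
qed

text \<open>In the product rule each summand keeps one factor undifferentiated;
  \<open>C_diff_on_SucD\<close> supplies that factor at the lower order.\<close>

lemma C_diff_on_bounded_bilinear:
  assumes "bounded_bilinear B" "open U" "C_diff_on m U f" "C_diff_on m U g"
  shows "C_diff_on m U (\<lambda>x. B (f x) (g x))"
  using assms(3,4)
proof (induction m arbitrary: f g)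
  case 0
  then show ?case using bounded_bilinear.continuous_on[OF assms(1)] by simp
next
  case (Suc m)
  show ?case
  proof (rule C_diff_on_SucI[OF assms(2)])
    show "((\<lambda>x. B (f x) (g x)) has_derivative
        (\<lambda>v. B (f x) (frechet_derivative g (at x) v) + B (frechet_derivative f (at x) v) (g x))) (at x)"
      if "x \<in> U" for x
      using Suc.prems that
      by (auto intro!: bounded_bilinear.FDERIV[OF assms(1)] simp: frechet_derivative_works)
    have "C_diff_on m U f" "C_diff_on m U g"
      using Suc.prems C_diff_on_SucD by blast+
    then show "C_diff_on m U
        (\<lambda>x. B (f x) (frechet_derivative g (at x) v) + B (frechet_derivative f (at x) v) (g x))" for v
      using Suc by (auto intro!: C_diff_on_add[OF assms(2)])
  qed
qed

section \<open>Matrix algebra\<close>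

lemma bounded_bilinear_matrix_mult:
  "bounded_bilinear ((**) :: real^'n^'m \<Rightarrow> real^'p^'n \<Rightarrow> real^'p^'m)"
  unfolding bilinear_conv_bounded_bilinear[symmetric] bilinear_def linear_iff
  by (simp add: matrix_matrix_mult_def Finite_Cartesian_Product.vec_eq_iff algebra_simps sum.distrib sum_distrib_left)

lemma bounded_bilinear_matrix_vector_mult:
  "bounded_bilinear ((*v) :: real^'n^'m \<Rightarrow> real^'n \<Rightarrow> real^'m)"
  unfolding bilinear_conv_bounded_bilinear[symmetric] bilinear_def linear_iff
  by (simp add: matrix_vector_mult_def Finite_Cartesian_Product.vec_eq_iff algebra_simps sum.distrib sum_distrib_left)

lemma bounded_linear_transpose: "bounded_linear (transpose :: real^'n^'m \<Rightarrow> real^'m^'n)"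
  unfolding linear_conv_bounded_linear[symmetric] linear_iff
  by (simp add: transpose_def Finite_Cartesian_Product.vec_eq_iff)

lemma bounded_linear_trace: "bounded_linear (trace :: real^'n^'n \<Rightarrow> real)"
  unfolding linear_conv_bounded_linear[symmetric] linear_iff
  by (simp add: trace_def sum.distrib sum_distrib_left)

text \<open>Products are expanded and nested to the right, the form in which
  \<open>involution_cancel\<close> can remove pairs \<open>Q ** Q\<close>.\<close>

lemmas matrix_ring_simps =
  bounded_bilinear.add_left[OF bounded_bilinear_matrix_mult]
  bounded_bilinear.add_right[OF bounded_bilinear_matrix_mult]
  bounded_bilinear.diff_left[OF bounded_bilinear_matrix_mult]
  bounded_bilinear.diff_right[OF bounded_bilinear_matrix_mult]
  bounded_bilinear.minus_left[OF bounded_bilinear_matrix_mult]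
  bounded_bilinear.minus_right[OF bounded_bilinear_matrix_mult]
  bounded_bilinear.scaleR_left[OF bounded_bilinear_matrix_mult]
  bounded_bilinear.scaleR_right[OF bounded_bilinear_matrix_mult]
  matrix_mul_assoc[symmetric]

lemmas transpose_simps =
  linear_add[OF bounded_linear.linear[OF bounded_linear_transpose]]
  linear_diff[OF bounded_linear.linear[OF bounded_linear_transpose]]
  linear_neg[OF bounded_linear.linear[OF bounded_linear_transpose]]
  linear_scale[OF bounded_linear.linear[OF bounded_linear_transpose]]
  matrix_transpose_mul
  linear_0[OF bounded_linear.linear[OF bounded_linear_transpose]]

lemma inner_eq_trace: "inner A B = trace (transpose A ** B)" for A B :: "real^'n^'m"
  unfolding inner_vec_def trace_def matrix_matrix_mult_def transpose_def
  by (simp, subst sum.swap, simp)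

lemma inner_transpose: "inner (transpose A) B = inner A (transpose B)"
  for A :: "real^'n^'m"
  unfolding inner_vec_def transpose_def
  by (simp, subst sum.swap, simp)

lemma inner_matrix_mult_left: "inner (C ** A) B = inner A (transpose C ** B)"
  for A :: "real^'n^'m"
  by (simp add: inner_eq_trace matrix_transpose_mul matrix_mul_assoc)

lemma inner_matrix_mult_right: "inner (A ** C) B = inner A (B ** transpose C)"
  for A :: "real^'n^'m"
proof -
  have "inner (A ** C) B = inner (transpose C ** transpose A) (transpose B)"
    using inner_transpose[of "A ** C" "transpose B"] by (simp add: matrix_transpose_mul)
  also have "\<dots> = inner (transpose A) (transpose (B ** transpose C))"
    by (simp add: inner_matrix_mult_left matrix_transpose_mul)
  finally show ?thesis by (simp add: inner_transpose)
qed

text \<open>\<open>axis i (axis j 1)\<close> is a matrix unit, so the product is column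
  \<open>i\<close> of \<open>A\<close> times row \<open>j\<close> of \<open>B\<close>.\<close>

lemma matrix_mult_axis_axis:
  fixes A :: "real^'n^'m" and B :: "real^'q^'p"
  shows "(A ** axis i (axis j 1) ** B) $ a $ b = A $ a $ i * B $ j $ b"
proof -
  have e: "(axis i (axis j 1) :: real^'p^'n) $ k $ l = (if k = i then if l = j then 1 else 0 else 0)"
    for k l
    by (simp add: axis_def)
  have "(A ** axis i (axis j 1)) $ a $ l = (if l = j then A $ a $ i else 0)" for l
  proof -
    have "(A ** axis i (axis j 1)) $ a $ l
        = (\<Sum>k\<in>UNIV. if k = i then if l = j then A $ a $ i else 0 else 0)"
      unfolding matrix_matrix_mult_def vec_lambda_beta by (intro sum.cong refl) (simp add: e)
    then show ?thesis by simp
  qed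
  then have "(A ** axis i (axis j 1) ** B) $ a $ b
      = (\<Sum>l\<in>UNIV. if l = j then A $ a $ i * B $ j $ b else 0)"
    unfolding matrix_matrix_mult_def[of "A ** axis i (axis j 1)"] vec_lambda_beta
    by (intro sum.cong refl) simp
  then show ?thesis by simp
qed

lemma transpose_axis_axis: "transpose (axis i (axis j 1) :: real^'n^'n) = axis j (axis i 1)"
  by (auto simp: transpose_def axis_def Finite_Cartesian_Product.vec_eq_iff)

text \<open>The standard basis consists of the matrix units; this turns the trace of an operator on
  matrices into a double sum over entries.\<close>

lemma sum_Basis_matrix:
  "(\<Sum>b\<in>Basis. f b) = (\<Sum>i\<in>UNIV. \<Sum>j\<in>UNIV. f (axis i (axis j (1::real)) :: real^'n^'m))"
proof -
  let ?e = "\<lambda>(i, j). axis i (axis j 1) :: real^'n^'m"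
  have img: "(Basis :: (real^'n^'m) set) = ?e ` (UNIV \<times> UNIV)"
    by (auto simp: Basis_vec_def image_iff)
  have inj: "inj_on ?e (UNIV \<times> UNIV)"
    by (auto simp: inj_on_def axis_eq_axis)
  have "(\<Sum>b\<in>Basis. f b) = (\<Sum>p\<in>UNIV \<times> UNIV. f (?e p))"
    unfolding img sum.reindex[OF inj] comp_def ..
  then show ?thesis
    by (simp only: sum.cartesian_product case_prod_unfold)
qed

text \<open>For an orthonormal basis \<open>B\<close> of the fixed space,
  \<open>inner (L x) x\<close> is the sum of the squared coefficients of \<open>x\<close>. Summing
  over the standard basis and exchanging sums, each unit vector of \<open>B\<close> contributes 1 by
  Parseval.\<close>

lemma dim_fixed_points_projection:
  fixes L :: "'a::euclidean_space \<Rightarrow> 'a"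
  assumes L: "linear L" and idem: "\<And>x. L (L x) = L x"
    and adj: "\<And>x y. inner (L x) y = inner x (L y)"
  shows "real (dim {x. L x = x}) = (\<Sum>b\<in>Basis. inner (L b) b)"
proof -
  let ?W = "{x. L x = x}"
  have "subspace ?W"
    by (auto simp: subspace_def linear_0[OF L] linear_add[OF L] linear_scale[OF L])
  then obtain B where B: "B \<subseteq> ?W" "pairwise Linear_Algebra.orthogonal B" "\<And>x. x \<in> B \<Longrightarrow> norm x = 1"
    "independent B" "card B = dim ?W" "span B = ?W"
    by (rule orthonormal_basis_subspace) blast
  have fin: "finite B"
    using B(4) by (rule independent_imp_finite)
  have "inner (L x) x = (\<Sum>w\<in>B. (inner x w)\<^sup>2)" for x
  proof -
    have "L x = (\<Sum>w\<in>B. inner (L x) w *\<^sub>R w)"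
      using orthonormal_basis_expand[OF B(2,3) _ fin, of "L x"] B(6) idem by simp
    also have "\<dots> = (\<Sum>w\<in>B. inner x w *\<^sub>R w)"
      using B(1) by (intro sum.cong refl) (auto simp: adj)
    finally have "inner (L x) x = inner (\<Sum>w\<in>B. inner x w *\<^sub>R w) x" by (rule arg_cong)
    also have "\<dots> = (\<Sum>w\<in>B. inner x w * inner w x)"
      by (simp only: inner_sum_left inner_scaleR_left)
    also have "\<dots> = (\<Sum>w\<in>B. (inner x w)\<^sup>2)"
      by (simp only: power2_eq_square inner_commute)
    finally show ?thesis .
  qed
  then have "(\<Sum>b\<in>Basis. inner (L b) b) = (\<Sum>b\<in>Basis. \<Sum>w\<in>B. (inner b w)\<^sup>2)"
    by (intro sum.cong refl)
  also have "\<dots> = (\<Sum>w\<in>B. \<Sum>b\<in>Basis. (inner b w)\<^sup>2)"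
    by (rule sum.swap)
  also have "\<dots> = (\<Sum>w\<in>B. 1)"
  proof (rule sum.cong)
    fix w assume "w \<in> B"
    then have "inner w w = 1" using B(3) by (simp add: norm_eq_1)
    moreover have "inner w w = (\<Sum>b\<in>Basis. (inner b w)\<^sup>2)"
      unfolding euclidean_inner[of w w] by (simp only: power2_eq_square inner_commute)
    ultimately show "(\<Sum>b\<in>Basis. (inner b w)\<^sup>2) = 1" by simp
  qed simp
  finally show ?thesis using B(5) by simp
qed

lemma involution_cancel: "Q ** Q = mat 1 \<Longrightarrow> Q ** (Q ** Z) = Z" for Q :: "real^'n^'n"
  by (simp add: matrix_mul_assoc)

section \<open>The Grassmannian as a submanifold\<close>

lemma Gr_iff:
  "Q \<in> Gr k \<longleftrightarrow> transpose Q = Q \<and> Q ** Q = mat 1 \<and> trace Q = 2 * real k - real CARD('n)"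
  for Q :: "real^'n^'n"
  by (auto simp: Gr_def orthogonal_matrix_def)

section \<open>Orthogonal projection onto the normal space at \<open>Q\<close>\<close>

definition sym_part :: "real^'n^'n \<Rightarrow> real^'n^'n" where
  "sym_part Y = (1/2) *\<^sub>R (Y + transpose Y)"

definition skew_part :: "real^'n^'n \<Rightarrow> real^'n^'n" where
  "skew_part Y = (1/2) *\<^sub>R (Y - transpose Y)"

text \<open>For an involution \<open>Q\<close> this averages \<open>Z\<close> over conjugation by
  \<open>Q\<close>, hence projects onto the matrices commuting with \<open>Q\<close>.\<close>

definition commuting_part :: "real^'n^'n \<Rightarrow> real^'n^'n \<Rightarrow> real^'n^'n" where
  "commuting_part Q Z = (1/2) *\<^sub>R (Z + Q ** Z ** Q)"

text \<open>For a symmetric involution \<open>Q\<close> the range is the skew matrices plus the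
  symmetric ones commuting with \<open>Q\<close>: the Frobenius-orthogonal complement of the
  symmetric matrices anticommuting with \<open>Q\<close>.\<close>

definition normal_proj :: "real^'n^'n \<Rightarrow> real^'n^'n \<Rightarrow> real^'n^'n" where
  "normal_proj Q Z = skew_part Z + commuting_part Q (sym_part Z)"

definition gr_defect :: "real^'n^'n \<Rightarrow> real^'n^'n \<Rightarrow> real^'n^'n" where
  "gr_defect Q Y = skew_part Y + commuting_part Q (sym_part Y ** sym_part Y - mat 1)"

lemma bounded_linear_sym_part: "bounded_linear sym_part"
  unfolding linear_conv_bounded_linear[symmetric] linear_iff sym_part_def
  by (simp add: transpose_simps algebra_simps)

lemma bounded_linear_skew_part: "bounded_linear skew_part"
  unfolding linear_conv_bounded_linear[symmetric] linear_iff skew_part_def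
  by (simp add: transpose_simps algebra_simps)

lemma bounded_linear_commuting_part: "bounded_linear (commuting_part Q)"
  unfolding linear_conv_bounded_linear[symmetric] linear_iff commuting_part_def
  by (simp add: matrix_ring_simps algebra_simps)

lemma linear_normal_proj: "linear (normal_proj Q)"
  unfolding linear_iff normal_proj_def sym_part_def skew_part_def commuting_part_def
  by (simp add: transpose_simps matrix_ring_simps algebra_simps)

lemmas matrix_normalize = transpose_simps matrix_ring_simps transpose_transpose transpose_mat
  matrix_mul_lid matrix_mul_rid scaleR_add_right scaleR_diff_right scaleR_minus_right scaleR_scaleR

lemmas part_defs = sym_part_def skew_part_def commuting_part_def

lemma normal_proj_idem:
  assumes "transpose Q = Q" "Q ** Q = mat 1"
  shows "normal_proj Q (normal_proj Q Z) = normal_proj Q Z"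
  unfolding normal_proj_def part_defs
  \<comment> \<open>Both sides become linear combinations of words in \<open>Q\<close>,
    \<open>Z\<close> and \<open>transpose Z\<close> without \<open>Q ** Q\<close>; the second call
    compares scalar coefficients entrywise.\<close>
  by (simp only: matrix_normalize assms involution_cancel[OF assms(2)])
    (simp add: Finite_Cartesian_Product.vec_eq_iff field_simps)

lemma normal_proj_adjoint:
  assumes "transpose Q = Q"
  shows "inner (normal_proj Q Y) Z = inner Y (normal_proj Q Z)"
proof -
  have sym: "inner (sym_part A) B = inner A (sym_part B)" for A B :: "real^'n^'n"
    by (simp add: sym_part_def inner_add_left inner_add_right inner_transpose)
  have skew: "inner (skew_part A) B = inner A (skew_part B)" for A B :: "real^'n^'n"
    by (simp add: skew_part_def inner_diff_left inner_diff_right inner_transpose)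
  have "inner (Q ** A ** Q) B = inner A (Q ** B ** Q)" for A B
    using inner_matrix_mult_right[of "Q ** A" Q B] inner_matrix_mult_left[of Q A "B ** Q"]
    by (simp add: assms matrix_mul_assoc)
  then have comm: "inner (commuting_part Q A) B = inner A (commuting_part Q B)" for A B
    by (simp add: commuting_part_def inner_add_left inner_add_right)
  \<comment> \<open>The composite of two commuting self-adjoint maps is self-adjoint.\<close>
  have "sym_part (commuting_part Q Z) = commuting_part Q (sym_part Z)"
    unfolding part_defs by (simp add: transpose_simps matrix_ring_simps assms algebra_simps)
  then show ?thesis
    by (simp add: normal_proj_def inner_add_left inner_add_right skew comm sym)
qed

text \<open>With n = \<open>CARD('n)\<close>, the trace of \<open>normal_proj Q\<close> is
  \<open>(3 n^2 + (2 k - n)^2) / 4 = n^2 - k (n - k)\<close>: the terms in \<open>Q\<close> enter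
  only through the squared trace and the squared Frobenius norm n.\<close>

lemma dim_normal_space:
  fixes Q :: "real^'n^'n"
  assumes "Q \<in> Gr k" "k \<le> CARD('n)"
  shows "dim {Z. normal_proj Q Z = Z} + k * (CARD('n) - k) = DIM(real^'n^'n)"
proof -
  define n where "n = real CARD('n)"
  have Q: "transpose Q = Q" "Q ** Q = mat 1" "trace Q = 2 * real k - n"
    using assms by (auto simp: Gr_iff n_def)
  have sq: "(\<Sum>i\<in>UNIV. \<Sum>j\<in>UNIV. Q $ i $ j * Q $ i $ j) = n"
  proof -
    have "inner Q Q = n"
      using Q by (simp add: inner_eq_trace trace_I n_def)
    then show ?thesis by (simp add: inner_vec_def)
  qed
  have tr: "(\<Sum>i\<in>UNIV. Q $ i $ i * (\<Sum>j\<in>UNIV. Q $ j $ j)) = (2 * real k - n)\<^sup>2"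
    unfolding Q(3)[symmetric] trace_def power2_eq_square by (simp only: sum_distrib_right)
  have delta: "(\<Sum>i\<in>(UNIV :: 'n set). \<Sum>j\<in>UNIV. if j = i then 1 else (0::real)) = n"
    "(\<Sum>i\<in>(UNIV :: 'n set). \<Sum>j\<in>(UNIV :: 'n set). 1 :: real) = n * n"
    by (simp_all add: n_def)
  \<comment> \<open>The products are left in this shape so that constants can be pulled out and the
    sums \<open>delta\<close>, \<open>tr\<close> and \<open>sq\<close> are recognized.\<close>
  have "inner (normal_proj Q (axis i (axis j 1))) (axis i (axis j 1)) =
      3/4 * 1 - 1/4 * (if j = i then 1 else 0) + 1/4 * (Q $ i $ i * Q $ j $ j)
      + 1/4 * (Q $ i $ j * Q $ i $ j)" for i j
  proof -
    let ?E = "axis i (axis j 1) :: real^'n^'n" and ?E' = "axis j (axis i 1) :: real^'n^'n"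
    have np: "normal_proj Q ?E = (1/2) *\<^sub>R (?E - ?E') + (1/4) *\<^sub>R (?E + ?E' + (Q ** ?E ** Q + Q ** ?E' ** Q))"
      unfolding normal_proj_def part_defs transpose_axis_axis by (simp add: matrix_normalize)
    have E: "inner ?E ?E = 1" "inner ?E' ?E = (if j = i then 1 else 0)"
      by (simp_all only: inner_axis) (simp_all add: axis_def)
    have QEQ: "inner (Q ** axis a (axis b 1) ** Q) ?E = Q $ i $ a * Q $ b $ j" for a b
      using matrix_mult_axis_axis[of Q a b Q i j] by (simp only: inner_axis inner_real_def mult_1_right)
    have "Q $ j $ i = Q $ i $ j"
      using arg_cong[OF Q(1), of "\<lambda>M. M $ i $ j"] by (simp add: transpose_def)
    then show ?thesis
      unfolding np inner_add_left inner_diff_left inner_scaleR_left E QEQ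
      by (simp add: field_simps)
  qed
  then have d: "real (dim {Z. normal_proj Q Z = Z}) =
      3/4 * (n * n) - 1/4 * n + 1/4 * (2 * real k - n)\<^sup>2 + 1/4 * n"
    using dim_fixed_points_projection[of "normal_proj Q", OF linear_normal_proj
        normal_proj_idem[OF Q(1,2)] normal_proj_adjoint[OF Q(1)]]
    by (simp only: sum_Basis_matrix sum.distrib sum_subtractf sum_distrib_left[symmetric] sq tr delta)
  have c: "real (CARD('n) - k) = n - real k"
    using assms(2) by (simp add: n_def)
  have "real (dim {Z. normal_proj Q Z = Z} + k * (CARD('n) - k)) = n * n"
    unfolding of_nat_add of_nat_mult c d by (simp add: power2_eq_square field_simps)
  then have "real (dim {Z. normal_proj Q Z = Z} + k * (CARD('n) - k)) = real DIM(real^'n^'n)"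
    by (simp add: n_def)
  then show ?thesis by linarith
qed

section \<open>The local defining map and its derivative\<close>

lemma normal_proj_gr_defect:
  assumes "transpose Q = Q" "Q ** Q = mat 1"
  shows "normal_proj Q (gr_defect Q Y) = gr_defect Q Y"
  unfolding normal_proj_def gr_defect_def part_defs
  by (simp only: matrix_normalize assms involution_cancel[OF assms(2)])
    (simp add: Finite_Cartesian_Product.vec_eq_iff field_simps)

lemma smooth_gr_defect: "smooth_on (ball Q r) (gr_defect Q)"
proof -
  have "C_diff_on m (ball Q r) (\<lambda>Y. skew_part Y +
      commuting_part Q (sym_part Y ** sym_part Y + - mat 1))" for m
    by (intro C_diff_on_add C_diff_on_bounded_linear[OF bounded_linear_skew_part]
        C_diff_on_bounded_linear[OF bounded_linear_commuting_part]
        C_diff_on_bounded_bilinear[OF bounded_bilinear_matrix_mult]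
        C_diff_on_bounded_linear[OF bounded_linear_sym_part] C_diff_on_const C_diff_on_ident open_ball)
  then show ?thesis
    by (simp add: smooth_on_def gr_defect_def[abs_def])
qed

text \<open>At \<open>Q\<close> the square of the symmetric part has derivative
  \<open>Q ** S + S ** Q\<close> with \<open>S = sym_part H\<close>. Conjugation by \<open>Q\<close>
  swaps the two terms, so \<open>commuting_part Q\<close> leaves the sum fixed.\<close>

lemma gr_defect_has_derivative:
  assumes "transpose Q = Q" "Q ** Q = mat 1"
  shows "(gr_defect Q has_derivative (\<lambda>H. skew_part H + (Q ** sym_part H + sym_part H ** Q))) (at Q)"
proof -
  have lin: "(f has_derivative f) (at x)" if "bounded_linear f" for f :: "real^'n^'n \<Rightarrow> real^'n^'n" and x
    using that by (rule bounded_linear_imp_has_derivative)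
  have "(gr_defect Q has_derivative (\<lambda>H. skew_part H + commuting_part Q
      (sym_part Q ** sym_part H + sym_part H ** sym_part Q - 0))) (at Q)"
    unfolding gr_defect_def[abs_def]
    by (intro has_derivative_add has_derivative_diff has_derivative_const lin bounded_linear_skew_part
        bounded_linear.has_derivative[OF bounded_linear_commuting_part]
        bounded_bilinear.FDERIV[OF bounded_bilinear_matrix_mult] bounded_linear_sym_part)
  moreover have "commuting_part Q (sym_part Q ** sym_part H + sym_part H ** sym_part Q - 0)
      = Q ** sym_part H + sym_part H ** Q" for H
    unfolding part_defs
    by (simp only: matrix_normalize assms involution_cancel[OF assms(2)])
      (simp add: Finite_Cartesian_Product.vec_eq_iff field_simps)
  ultimately show ?thesis by simp
qed

lemma range_gr_defect_derivative:
  assumes Q: "transpose Q = Q" "Q ** Q = mat 1"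
  shows "range (frechet_derivative (gr_defect Q) (at Q)) = {Z. normal_proj Q Z = Z}"
proof -
  let ?D = "\<lambda>H. skew_part H + (Q ** sym_part H + sym_part H ** Q)"
  have D: "frechet_derivative (gr_defect Q) (at Q) = ?D"
    using frechet_derivative_at[OF gr_defect_has_derivative[OF Q]] by simp
  have 1: "normal_proj Q (?D H) = ?D H" for H
    unfolding normal_proj_def part_defs
    by (simp only: matrix_normalize Q involution_cancel[OF Q(2)])
      (simp add: Finite_Cartesian_Product.vec_eq_iff field_simps)
  have 2: "Z \<in> range ?D" if Z: "normal_proj Q Z = Z" for Z
  proof
    \<comment> \<open>The preimage of \<open>Z\<close> is
      \<open>skew_part Z + (1/2) *\<^sub>R (P ** Q)\<close>: since \<open>P\<close> commutes with
      \<open>Q\<close>, the product \<open>P ** Q\<close> is symmetric, and multiplying its half by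
      \<open>Q\<close> on the left and on the right and adding returns \<open>P\<close>.\<close>
    define P where "P = commuting_part Q (sym_part Z)"
    have P: "transpose P = P" "Q ** P = P ** Q"
      unfolding P_def part_defs
      by (simp_all add: transpose_simps matrix_ring_simps Q involution_cancel add_ac)
    have s: "sym_part (skew_part Z + (1/2) *\<^sub>R (P ** Q)) = (1/2) *\<^sub>R (P ** Q)"
      unfolding sym_part_def skew_part_def
      by (simp add: transpose_simps P Q Finite_Cartesian_Product.vec_eq_iff field_simps)
    have k: "skew_part (skew_part Z + (1/2) *\<^sub>R (P ** Q)) = skew_part Z"
      unfolding sym_part_def skew_part_def
      by (simp add: transpose_simps P Q Finite_Cartesian_Product.vec_eq_iff field_simps)
    have "Q ** (P ** Q) = P" "P ** Q ** Q = P"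
      using P Q by (simp_all add: matrix_mul_assoc[symmetric] involution_cancel flip: P(2))
    then have "?D (skew_part Z + (1/2) *\<^sub>R (P ** Q)) = skew_part Z + P"
      unfolding s k by (simp add: matrix_ring_simps flip: scaleR_add_left)
    then show "Z = ?D (skew_part Z + (1/2) *\<^sub>R (P ** Q))"
      using Z by (simp add: normal_proj_def P_def)
  qed simp
  show ?thesis unfolding D using 1 2 by blast
qed

section \<open>The zero set of the defining map near \<open>Q\<close>\<close>

text \<open>With \<open>T = mat 1 + S ** Q\<close>, both \<open>S ** T\<close> and
  \<open>T ** Q\<close> equal \<open>S + Q\<close>; the trivial kernel makes \<open>T\<close>
  invertible, so \<open>S\<close> and \<open>Q\<close> are similar.\<close>

lemma trace_involution_eq:
  fixes S Q :: "real^'n^'n"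
  assumes "S ** S = mat 1" "Q ** Q = mat 1"
    and ker: "\<And>x. (mat 1 + S ** Q) *v x = 0 \<Longrightarrow> x = 0"
  shows "trace S = trace Q"
proof -
  let ?T = "mat 1 + S ** Q"
  obtain R where R: "R ** ?T = mat 1"
    using ker matrix_left_invertible_ker[of ?T] by blast
  then have R': "?T ** R = mat 1"
    using matrix_left_right_inverse by blast
  have ST: "S ** ?T = ?T ** Q"
    by (simp add: matrix_ring_simps assms involution_cancel add.commute)
  have "trace S = trace (S ** (?T ** R))"
    by (simp add: R')
  also have "\<dots> = trace ((?T ** Q) ** R)"
    by (simp only: ST matrix_mul_assoc)
  also have "\<dots> = trace (R ** (?T ** Q))"
    by (rule trace_mul_sym)
  also have "\<dots> = trace Q"
    by (simp only: matrix_mul_assoc R matrix_mul_lid)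
  finally show ?thesis .
qed

lemma norm_involution_mult:
  fixes Z :: "real^'m^'n"
  assumes "transpose Q = Q" "Q ** Q = mat 1"
  shows "norm (Q ** Z) = norm Z"
  by (simp add: norm_eq_sqrt_inner inner_matrix_mult_left assms matrix_mul_assoc)

lemma norm_involution_vector:
  fixes x :: "real^'n"
  assumes "transpose Q = Q" "Q ** Q = mat 1"
  shows "norm (Q *v x) = norm x"
proof -
  have "inner (Q *v x) (Q *v x) = inner x (Q *v (Q *v x))"
    by (metis assms(1) dot_lmul_matrix transpose_matrix_vector)
  then show ?thesis
    by (simp add: norm_eq_sqrt_inner matrix_vector_mul_assoc assms(2))
qed

lemma gr_local_zero_set:
  fixes Q :: "real^'n^'n"
  assumes "Q \<in> Gr k"
  shows "\<exists>r>0. Gr k \<inter> ball Q r = {Y \<in> ball Q r. gr_defect Q Y = 0}"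
proof -
  have Q: "transpose Q = Q" "Q ** Q = mat 1" "trace Q = 2 * real k - real CARD('n)"
    using assms by (auto simp: Gr_iff)
  obtain K where K: "K > 0" "\<And>A B. norm ((A::real^'n^'n) ** (B::real^'n^'n)) \<le> norm A * norm B * K"
    using bounded_bilinear.pos_bounded[OF bounded_bilinear_matrix_mult] by blast
  obtain L where L: "L > 0" "\<And>A x. norm ((A::real^'n^'n) *v x) \<le> norm A * norm x * L"
    using bounded_bilinear.pos_bounded[OF bounded_bilinear_matrix_vector_mult] by blast
  \<comment> \<open>The bound by \<open>1 / K\<close> makes the commutator estimate strict and
    yields \<open>E = 0\<close>; the bound by \<open>1 / L\<close> yields the trivial
    kernel.\<close>
  define r where "r = min (1 / K) (1 / L)"
  have "r > 0" using K(1) L(1) by (simp add: r_def)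
  have inGr: "Y \<in> Gr k" if Y: "Y \<in> ball Q r" "gr_defect Q Y = 0" for Y
  proof -
    define D where "D = Y - Q"
    have nD: "norm D < r"
      using Y(1) by (simp add: D_def dist_norm norm_minus_commute)
    then have D: "norm D * K < 1" "norm D * L < 1"
      using K(1) L(1) by (auto simp: r_def field_simps)
    let ?E = "sym_part Y ** sym_part Y - mat 1"
    \<comment> \<open>One summand of the defect is skew and the other symmetric, so a vanishing sum
      forces both to vanish.\<close>
    have sk: "transpose (skew_part Y) = - skew_part Y"
      by (simp add: skew_part_def transpose_simps algebra_simps)
    have "transpose (commuting_part Q ?E) = commuting_part Q ?E"
      unfolding part_defs by (simp only: matrix_normalize Q(1)) (simp add: algebra_simps)
    moreover have "commuting_part Q ?E = - skew_part Y"
      using Y(2) unfolding gr_defect_def by (simp add: eq_neg_iff_add_eq_0 add.commute)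
    ultimately have "skew_part Y = - skew_part Y"
      using sk by (metis minus_minus transpose_simps(3))
    then have "skew_part Y = 0"
      by (simp add: Finite_Cartesian_Product.vec_eq_iff)
    then have sym: "transpose Y = Y"
      by (simp add: skew_part_def)
    then have S: "sym_part Y = Y"
      by (simp add: sym_part_def flip: scaleR_2)
    define E where "E = Y ** Y - mat 1"
    have "commuting_part Q E = 0"
      using Y(2) \<open>skew_part Y = 0\<close> by (simp add: gr_defect_def S E_def)
    then have "E + Q ** E ** Q = 0"
      by (simp add: commuting_part_def)
    \<comment> \<open>Multiplication by \<open>Q\<close> turns this relation into anticommutation of
      \<open>E\<close> with \<open>Q\<close>.\<close>
    then have "Q ** (E + Q ** E ** Q) = Q ** 0" by simp
    then have QE: "Q ** E = - (E ** Q)"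
      by (simp add: matrix_ring_simps involution_cancel Q eq_neg_iff_add_eq_0)
    \<comment> \<open>\<open>E\<close> is a polynomial in \<open>Y\<close>. Substituting
      \<open>D = Y - Q\<close>, the commutator of \<open>E\<close> with \<open>D\<close> reduces to
      \<open>Q ** E - E ** Q\<close>, which is twice \<open>Q ** E\<close>.\<close>
    have "E ** Y = Y ** E"
      by (simp add: E_def matrix_ring_simps)
    then have "2 *\<^sub>R (Q ** E) = E ** D - D ** E"
      using QE by (simp add: D_def matrix_ring_simps scaleR_2)
    then have "2 * norm E = norm (E ** D - D ** E)"
      using norm_involution_mult[OF Q(1,2), of E] by (metis abs_numeral norm_scaleR)
    also have "\<dots> \<le> norm (E ** D) + norm (D ** E)"
      by (rule norm_triangle_ineq4)
    also have "\<dots> \<le> 2 * (norm D * K) * norm E"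
      using K(2)[of E D] K(2)[of D E] by (simp add: algebra_simps)
    finally have "norm E * (1 - norm D * K) \<le> 0"
      by (simp add: algebra_simps)
    then have "E = 0"
      using D(1) by (simp add: mult_le_0_iff)
    then have YY: "Y ** Y = mat 1"
      by (simp add: E_def)
    have "x = 0" if x: "(mat 1 + Y ** Q) *v x = 0" for x
    proof -
      \<comment> \<open>Here \<open>Y ** Q = mat 1 + D ** Q\<close>; a kernel vector then has
        \<open>2 x = - D Q x\<close>, impossible for small \<open>D\<close> unless
        \<open>x = 0\<close>.\<close>
      have "(mat 1 + Y ** Q) *v x = 2 *\<^sub>R x + D *v (Q *v x)"
        by (simp add: D_def matrix_ring_simps matrix_vector_mul_assoc Q scaleR_2
            matrix_vector_mult_add_rdistrib matrix_vector_mult_diff_rdistrib)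
      then have "2 *\<^sub>R x = - (D *v (Q *v x))"
        using x by (simp add: eq_neg_iff_add_eq_0)
      then have "2 * norm x = norm (D *v (Q *v x))"
        by (metis abs_numeral norm_minus_cancel norm_scaleR)
      also have "\<dots> \<le> norm x * (norm D * L)"
        using L(2)[of D "Q *v x"] norm_involution_vector[OF Q(1,2)] by (simp add: mult_ac)
      also have "\<dots> \<le> norm x * 1"
        using D(2) by (intro mult_left_mono) auto
      finally show "x = 0" by simp
    qed
    then have "trace Y = trace Q"
      using trace_involution_eq[OF YY Q(2)] by blast
    with sym YY Q(3) show ?thesis by (simp add: Gr_iff)
  qed
  have "gr_defect Q Y = 0" if "Y \<in> Gr k" for Y
    using that by (simp add: Gr_iff gr_defect_def part_defs flip: scaleR_2)
  with inGr \<open>r > 0\<close> show ?thesis by blast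
qed

lemma embedded_submanifold_Gr:
  assumes "k \<le> CARD('n)"
  shows "embedded_submanifold (k * (CARD('n) - k)) (Gr k :: (real^'n^'n) set)"
  unfolding embedded_submanifold_def
proof
  fix Q :: "real^'n^'n" assume Q: "Q \<in> Gr k"
  then have Q': "transpose Q = Q" "Q ** Q = mat 1"
    by (auto simp: Gr_iff)
  obtain r where r: "r > 0" "Gr k \<inter> ball Q r = {Y \<in> ball Q r. gr_defect Q Y = 0}"
    using gr_local_zero_set[OF Q] by blast
  have "subspace {Z. normal_proj Q Z = Z}"
    using linear_normal_proj[of Q] by (auto simp: subspace_def linear_0 linear_add linear_scale)
  then show "\<exists>U W (h :: real^'n^'n \<Rightarrow> real^'n^'n).
        Q \<in> U \<and> smooth_on U h \<and> subspace W \<and>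
        dim W + k * (CARD('n) - k) = DIM(real^'n^'n) \<and> h ` U \<subseteq> W \<and>
        range (frechet_derivative h (at Q)) = W \<and> Gr k \<inter> U = {y \<in> U. h y = 0}"
    using r smooth_gr_defect dim_normal_space[OF Q assms] normal_proj_gr_defect[OF Q']
      range_gr_defect_derivative[OF Q']
    by (intro exI[of _ "ball Q r"] exI[of _ "{Z. normal_proj Q Z = Z}"] exI[of _ "gr_defect Q"]) auto
qed

section \<open>Tangent spaces\<close>

text \<open>For skew \<open>A\<close> the vector \<open>A *v x\<close> is orthogonal to
  \<open>x\<close>, so Pythagoras applies. This gives both invertibility of
  \<open>mat 1 - t *\<^sub>R A\<close> for every \<open>t\<close> and a bound on the inverse uniform
  in \<open>t\<close>.\<close>

lemma skew_resolvent_norm: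
  fixes A :: "real^'n^'n"
  assumes "transpose A = - A"
  shows "norm x \<le> norm ((mat 1 - t *\<^sub>R A) *v x)"
proof -
  have "inner x (A *v x) = inner (transpose A *v x) x"
    by (simp add: dot_lmul_matrix)
  also have "\<dots> = - inner (A *v x) x"
    unfolding assms by (simp add: bounded_bilinear.minus_left[OF bounded_bilinear_matrix_vector_mult])
  finally have "inner x (A *v x) = 0"
    by (simp add: inner_commute)
  moreover have "(mat 1 - t *\<^sub>R A) *v x = x - t *\<^sub>R (A *v x)"
    by (simp add: bounded_bilinear.diff_left[OF bounded_bilinear_matrix_vector_mult]
        bounded_bilinear.scaleR_left[OF bounded_bilinear_matrix_vector_mult])
  ultimately have "(norm ((mat 1 - t *\<^sub>R A) *v x))\<^sup>2 = (norm x)\<^sup>2 + t\<^sup>2 * (norm (A *v x))\<^sup>2"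
    unfolding power2_norm_eq_inner
    by (simp add: inner_diff_left inner_diff_right inner_commute power2_eq_square)
  then have "(norm x)\<^sup>2 \<le> (norm ((mat 1 - t *\<^sub>R A) *v x))\<^sup>2"
    by simp
  then show ?thesis
    by (simp add: power2_le_iff_abs_le)
qed

lemma norm_matrix_le_sum: "norm A \<le> (\<Sum>i\<in>UNIV. \<Sum>j\<in>UNIV. \<bar>A $ i $ j\<bar>)" for A :: "real^'n^'m"
proof -
  have "norm A \<le> (\<Sum>i\<in>UNIV. norm (A $ i))"
    unfolding norm_vec_def by (rule L2_set_le_sum) simp
  also have "\<dots> \<le> (\<Sum>i\<in>UNIV. \<Sum>j\<in>UNIV. \<bar>A $ i $ j\<bar>)"
    by (intro sum_mono norm_le_l1_cart)
  finally show ?thesis .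
qed

text \<open>The resolvent identity \<open>diff\<close> is used twice: with the bound
  \<open>M\<close> it gives continuity of \<open>N\<close> at \<open>t\<close>, and then it writes
  the remainder quotient as the norm of \<open>(N s - N t) ** (A ** N t)\<close>, which tends to
  0.\<close>

lemma resolvent_has_derivative:
  fixes A :: "real^'n^'n" and N :: "real \<Rightarrow> real^'n^'n"
  assumes left: "\<And>t. N t ** (mat 1 - t *\<^sub>R A) = mat 1"
    and right: "\<And>t. (mat 1 - t *\<^sub>R A) ** N t = mat 1"
    and bound: "\<And>t. norm (N t) \<le> M"
  shows "(N has_derivative (\<lambda>h. h *\<^sub>R (N t ** A ** N t))) (at t)"
proof -
  have diff: "N s - N t = (s - t) *\<^sub>R (N s ** A ** N t)" for s t
  proof -
    have "N s - N t = N s ** ((mat 1 - t *\<^sub>R A) ** N t) - (N s ** (mat 1 - s *\<^sub>R A)) ** N t"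
      by (simp add: left right)
    also have "\<dots> = (s - t) *\<^sub>R (N s ** A ** N t)"
      by (simp add: matrix_ring_simps algebra_simps)
    finally show ?thesis .
  qed
  obtain K where K: "K > 0" "\<And>A B. norm ((A::real^'n^'n) ** (B::real^'n^'n)) \<le> norm A * norm B * K"
    using bounded_bilinear.pos_bounded[OF bounded_bilinear_matrix_mult] by blast
  have "((\<lambda>s. N s - N t) \<longlongrightarrow> 0) (at t)"
  proof (rule Lim_null_comparison)
    show "\<forall>\<^sub>F s in at t. norm (N s - N t) \<le> \<bar>s - t\<bar> * (M * norm (A ** N t) * K)"
    proof (intro always_eventually allI)
      fix s
      have "norm (N s ** (A ** N t)) \<le> norm (N s) * norm (A ** N t) * K"
        by (rule K(2))
      also have "\<dots> \<le> M * norm (A ** N t) * K"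
        using K(1) bound by (intro mult_right_mono) auto
      finally show "norm (N s - N t) \<le> \<bar>s - t\<bar> * (M * norm (A ** N t) * K)"
        unfolding diff by (simp add: mult_left_mono matrix_mul_assoc)
    qed
    show "((\<lambda>s. \<bar>s - t\<bar> * (M * norm (A ** N t) * K)) \<longlongrightarrow> 0) (at t)"
      by (auto intro!: tendsto_eq_intros)
  qed
  then have "((\<lambda>s. norm ((N s - N t) ** (A ** N t))) \<longlongrightarrow> 0) (at t)"
    by (intro tendsto_norm_zero bounded_bilinear.tendsto_left_zero[OF bounded_bilinear_matrix_mult])
  moreover have "norm (N s - N t - (s - t) *\<^sub>R (N t ** A ** N t)) / norm (s - t)
      = norm ((N s - N t) ** (A ** N t))" if "s \<noteq> t" for s
  proof -
    have "N s - N t - (s - t) *\<^sub>R (N t ** A ** N t) = (s - t) *\<^sub>R ((N s - N t) ** (A ** N t))"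
      by (subst diff) (simp add: matrix_ring_simps scaleR_diff_right)
    then show ?thesis
      using that by simp
  qed
  ultimately have "((\<lambda>s. norm (N s - N t - (s - t) *\<^sub>R (N t ** A ** N t)) / norm (s - t)) \<longlongrightarrow> 0) (at t)"
    by (subst tendsto_cong[where g = "\<lambda>s. norm ((N s - N t) ** (A ** N t))"])
      (auto simp: eventually_at_filter)
  then show ?thesis
    by (simp add: has_derivative_iff_norm bounded_linear_scaleR_left)
qed

text \<open>The derivative is built by products from \<open>N\<close> and the constant
  \<open>A\<close>, so smoothness of order \<open>m\<close> bootstraps to order
  \<open>Suc m\<close>.\<close>

lemma C_diff_on_resolvent:
  fixes A :: "real^'n^'n" and N :: "real \<Rightarrow> real^'n^'n"
  assumes "open U" "\<And>t. (N has_derivative (\<lambda>h. h *\<^sub>R (N t ** A ** N t))) (at t)"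
  shows "C_diff_on m U N"
proof (induction m)
  case 0
  have "continuous_on U N"
    using assms(2) has_derivative_continuous by (blast intro: continuous_at_imp_continuous_on)
  then show ?case by simp
next
  case (Suc m)
  show ?case
    by (intro C_diff_on_SucI[OF assms] C_diff_on_bounded_linear[OF bounded_linear_scaleR_right assms(1)]
        C_diff_on_bounded_bilinear[OF bounded_bilinear_matrix_mult assms(1)] Suc C_diff_on_const)
qed

text \<open>The curve through \<open>Q\<close> with velocity \<open>X\<close> is \<open>R(t) Q R(t)\<^sup>T = R(t)\<^sup>2 Q\<close>, where
  \<open>R(t) = (1 + tA)(1 - tA)\<^sup>-\<^sup>1 = 2N(t) - 1\<close> is the Cayley transform of the skew matrix
  \<open>tA = tXQ/4\<close> and \<open>N(t) = (1 - tA)\<^sup>-\<^sup>1\<close>.\<close>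

lemma tangent_space_Gr_superset:
  fixes Q X :: "real^'n^'n"
  assumes Q: "Q \<in> Gr k" and X: "transpose X = X" "Q ** X + X ** Q = 0"
  shows "X \<in> tangent_space (Gr k) Q"
proof -
  have Q': "transpose Q = Q" "Q ** Q = mat 1"
    using Q by (auto simp: Gr_iff)
  \<comment> \<open>The factor 1/4: \<open>R\<close> has derivative \<open>2 *\<^sub>R A\<close> at
    0 and occurs twice in \<open>c\<close>, so the velocity of \<open>c\<close> is 4 times
    \<open>A ** Q\<close>, which must equal \<open>X\<close>.\<close>
  define A where "A = (1/4) *\<^sub>R (X ** Q)"
  have QX: "Q ** X = - (X ** Q)"
    using X(2) by (simp add: eq_neg_iff_add_eq_0)
  have A: "transpose A = - A"
    unfolding A_def by (simp add: matrix_normalize X Q' QX)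
  have QA: "Q ** A = - (A ** Q)"
    unfolding A_def by (simp add: matrix_normalize Q') (simp add: matrix_mul_assoc QX matrix_normalize Q')
  have "\<exists>N. N ** (mat 1 - t *\<^sub>R A) = mat 1" for t
  proof -
    have "x = 0" if "(mat 1 - t *\<^sub>R A) *v x = 0" for x
      using skew_resolvent_norm[OF A, of x t] that by simp
    then show ?thesis
      using matrix_left_invertible_ker by blast
  qed
  then obtain N where left: "\<And>t. N t ** (mat 1 - t *\<^sub>R A) = mat 1"
    by metis
  then have right: "\<And>t. (mat 1 - t *\<^sub>R A) ** N t = mat 1"
    using matrix_left_right_inverse by blast
  have "norm (N t) \<le> real CARD('n) * real CARD('n)" for t
  proof -
    \<comment> \<open>Column \<open>j\<close> of \<open>N t\<close> is the image of
      \<open>axis j 1\<close>, and by the resolvent bound its norm is at most 1.\<close>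
    have "\<bar>N t $ i $ j\<bar> \<le> 1" for i j
    proof -
      have "\<bar>N t $ i $ j\<bar> = \<bar>(N t *v axis j 1) $ i\<bar>"
        by (simp add: matrix_vector_mult_basis column_def)
      also have "\<dots> \<le> norm (N t *v axis j 1)"
        by (rule component_le_norm_cart)
      also have "\<dots> \<le> norm ((mat 1 - t *\<^sub>R A) *v (N t *v axis j 1))"
        by (rule skew_resolvent_norm[OF A])
      also have "\<dots> = 1"
        by (simp only: matrix_vector_mul_assoc right matrix_vector_mul_lid norm_axis_1)
      finally show ?thesis .
    qed
    then have "(\<Sum>i\<in>UNIV. \<Sum>j\<in>UNIV. \<bar>N t $ i $ j\<bar>) \<le> (\<Sum>i\<in>(UNIV::'n set). \<Sum>j\<in>(UNIV::'n set). 1)"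
      by (intro sum_mono)
    then show ?thesis
      using norm_matrix_le_sum[of "N t"] by simp
  qed
  then have dN: "(N has_derivative (\<lambda>h. h *\<^sub>R (N t ** A ** N t))) (at t)" for t
    by (rule resolvent_has_derivative[OF left right])
  define R where "R = (\<lambda>t. 2 *\<^sub>R N t + - mat 1)"
  define c where "c = (\<lambda>t. R t ** R t ** Q)"
  have "C_diff_on m {-1<..<1} N" for m
    by (rule C_diff_on_resolvent[OF open_greaterThanLessThan dN])
  then have "C_diff_on m {-1<..<1} c" for m
    unfolding c_def R_def
    by (intro C_diff_on_bounded_bilinear[OF bounded_bilinear_matrix_mult] C_diff_on_add
        C_diff_on_bounded_linear[OF bounded_linear_scaleR_right]
        C_diff_on_const open_greaterThanLessThan)
  then have smooth: "smooth_on {-1<..<1} c"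
    by (simp add: smooth_on_def)
  have N0: "N 0 = mat 1"
    using left[of 0] by simp
  have "(N has_vector_derivative A) (at 0)"
    using dN[of 0] by (simp add: has_vector_derivative_def N0)
  then have dR: "(R has_vector_derivative 2 *\<^sub>R A) (at 0)"
    unfolding R_def by (auto intro!: derivative_eq_intros)
  have R0: "R 0 = mat 1"
    by (simp add: R_def N0 scaleR_2)
  have "(c has_vector_derivative (R 0 ** R 0 ** 0 + (R 0 ** (2 *\<^sub>R A) + (2 *\<^sub>R A) ** R 0) ** Q)) (at 0)"
    unfolding c_def
    by (intro bounded_bilinear.has_vector_derivative[OF bounded_bilinear_matrix_mult] dR
        has_vector_derivative_const)
  moreover have "R 0 ** R 0 ** 0 + (R 0 ** (2 *\<^sub>R A) + (2 *\<^sub>R A) ** R 0) ** Q = X"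
    by (simp add: R0 A_def matrix_normalize Q' flip: scaleR_add_left)
  ultimately have dc: "(c has_vector_derivative X) (at 0)"
    by simp
  have "c t \<in> Gr k" for t
  proof -
    let ?P = "mat 1 - t *\<^sub>R A" and ?P' = "mat 1 + t *\<^sub>R A"
    have tP: "transpose ?P = ?P'"
      by (simp add: matrix_normalize A)
    \<comment> \<open>The form \<open>2 N - 1\<close> served smoothness; this product form of the
      Cayley transform serves orthogonality.\<close>
    have R1: "R t = N t ** ?P'"
    proof -
      have "N t - t *\<^sub>R (N t ** A) = mat 1"
        using left[of t] by (simp add: matrix_ring_simps)
      then have "t *\<^sub>R (N t ** A) = N t - mat 1"
        by (simp add: algebra_simps)
      then show ?thesis
        by (simp add: R_def matrix_ring_simps scaleR_2)
    qed
    have tN: "?P' ** transpose (N t) = mat 1" "transpose (N t) ** ?P' = mat 1"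
      using arg_cong[OF left, of transpose t] arg_cong[OF right, of transpose t]
      by (simp_all add: matrix_transpose_mul tP)
    have tR: "transpose (R t) = ?P ** transpose (N t)"
      using arg_cong[OF tP, of transpose] by (simp add: R1 matrix_transpose_mul)
    have comm: "?P' ** ?P = ?P ** ?P'"
      by (simp only: matrix_normalize) simp
    have RR: "R t ** transpose (R t) = mat 1"
    proof -
      have "R t ** transpose (R t) = N t ** (?P' ** ?P) ** transpose (N t)"
        unfolding tR by (simp only: R1 matrix_mul_assoc)
      also have "\<dots> = (N t ** ?P) ** (?P' ** transpose (N t))"
        by (simp only: comm matrix_mul_assoc)
      finally show ?thesis
        by (simp add: left tN)
    qed
    then have RR': "transpose (R t) ** R t = mat 1"
      using matrix_left_right_inverse by blast
    \<comment> \<open>Anticommuting with \<open>A\<close>, \<open>Q\<close> exchanges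
      \<open>?P\<close> and \<open>?P'\<close>, hence also \<open>N t\<close> and its transpose.
      Therefore \<open>transpose (R t) ** Q = Q ** R t\<close>, which identifies \<open>c t\<close>
      with a conjugate of \<open>Q\<close>.\<close>
    have QP: "Q ** ?P = ?P' ** Q"
      by (simp add: matrix_ring_simps QA)
    have "transpose (N t) ** Q = Q ** N t"
    proof -
      have "transpose (N t) ** Q = transpose (N t) ** (Q ** ?P) ** N t"
        by (simp add: matrix_mul_assoc[symmetric] right)
      also have "\<dots> = Q ** N t"
        by (simp add: QP matrix_mul_assoc tN)
      finally show ?thesis .
    qed
    then have RQ: "transpose (R t) ** Q = Q ** R t"
      by (simp add: R_def matrix_normalize)
    have "Q ** (transpose (R t) ** Q) ** Q = Q ** (Q ** R t) ** Q"
      by (simp only: RQ)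
    then have QR: "Q ** transpose (R t) = R t ** Q"
      by (simp add: matrix_mul_assoc[symmetric] Q' involution_cancel[OF Q'(2)])
    have c: "c t = R t ** Q ** transpose (R t)"
      by (simp add: c_def QR flip: matrix_mul_assoc)
    have "transpose (c t) = c t"
      by (simp add: c matrix_transpose_mul Q' matrix_mul_assoc)
    moreover have "c t ** c t = mat 1"
    proof -
      have "c t ** c t = R t ** Q ** (transpose (R t) ** R t) ** Q ** transpose (R t)"
        by (simp only: c matrix_mul_assoc)
      also have "\<dots> = R t ** (Q ** Q) ** transpose (R t)"
        by (simp only: RR' matrix_mul_assoc matrix_mul_rid)
      finally show ?thesis by (simp add: Q' RR)
    qed
    moreover have "trace (c t) = trace Q"
      using trace_mul_sym[of "R t ** Q" "transpose (R t)"] by (simp add: c matrix_mul_assoc RR')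
    ultimately show ?thesis
      using Q by (simp add: Gr_iff)
  qed
  then show ?thesis
    unfolding tangent_space_def using smooth dc
    by (auto intro!: exI[of _ "1::real"] exI[of _ c] simp: c_def R0)
qed

text \<open>Along a curve in the Grassmannian, \<open>transpose (c t) = c t\<close> and
  \<open>c t ** c t = mat 1\<close>; differentiating these at 0 gives the two linear
  conditions.\<close>

lemma tangent_space_Gr_subset:
  fixes Q X :: "real^'n^'n"
  assumes "X \<in> tangent_space (Gr k) Q"
  shows "transpose X = X" "Q ** X + X ** Q = 0"
proof -
  obtain r c where c: "r > 0" "c ` {-r<..<r} \<subseteq> Gr k" "c 0 = Q"
    and d: "(c has_vector_derivative X) (at 0)"
    using assms unfolding tangent_space_def by blast
  have I: "open {-r<..<r}" "0 \<in> {-r<..<r}"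
    using c(1) by auto
  have G: "transpose (c t) = c t" "c t ** c t = mat 1" if "t \<in> {-r<..<r}" for t
    using c(2) that by (auto simp: Gr_iff image_subset_iff)
  have "((\<lambda>t. transpose (c t)) has_vector_derivative transpose X) (at 0)"
    by (rule bounded_linear.has_vector_derivative[OF bounded_linear_transpose d])
  then have "(c has_vector_derivative transpose X) (at 0)"
    by (rule has_vector_derivative_transform_within_open[OF _ I]) (rule G(1))
  then show "transpose X = X"
    using d by (rule vector_derivative_unique_at)
  have "((\<lambda>t. c t ** c t) has_vector_derivative (c 0 ** X + X ** c 0)) (at 0)"
    by (rule bounded_bilinear.has_vector_derivative[OF bounded_bilinear_matrix_mult d d])
  then have "((\<lambda>t. mat 1) has_vector_derivative (c 0 ** X + X ** c 0)) (at 0)"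
    by (rule has_vector_derivative_transform_within_open[OF _ I]) (rule G(2))
  then show "Q ** X + X ** Q = 0"
    using vector_derivative_unique_at[OF _ has_vector_derivative_const] c(3) by blast
qed

lemma tangent_space_Gr:
  assumes "Q \<in> Gr k"
  shows "tangent_space (Gr k) Q = {X. transpose X = X \<and> Q ** X + X ** Q = 0}"
  using tangent_space_Gr_superset[OF assms] tangent_space_Gr_subset by blast

section \<open>The trace metric\<close>

lemma riemannian_metric_Gr:
  assumes "k \<le> CARD('n)"
  shows "riemannian_metric (Gr k :: (real^'n^'n) set) gr_metric"
  unfolding riemannian_metric_def
proof (intro conjI ballI allI impI)
  show "\<exists>d. embedded_submanifold d (Gr k :: (real^'n^'n) set)"
    using embedded_submanifold_Gr[OF assms] by blast
next
  fix Q :: "real^'n^'n" assume Q: "Q \<in> Gr k"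
  have "subspace {X. transpose X = X \<and> Q ** X + X ** Q = 0}"
    unfolding eq_neg_iff_add_eq_0[symmetric]
    by (auto simp: subspace_def transpose_simps matrix_ring_simps)
  \<comment> \<open>For symmetric \<open>X\<close> this trace is the squared Frobenius norm, whence
    positivity on tangent vectors.\<close>
  moreover have "trace (X ** X) > 0" if "transpose X = X" "X \<noteq> 0" for X :: "real^'n^'n"
    using that inner_eq_trace[of X X] inner_gt_zero_iff[of X] by simp
  ultimately show "inner_product_on (tangent_space (Gr k) Q) (gr_metric Q)"
    unfolding inner_product_on_def tangent_space_Gr[OF Q] gr_metric_def
    by (auto simp: trace_add linear_scale[OF bounded_linear.linear[OF bounded_linear_trace]]
        matrix_ring_simps intro: trace_mul_sym)
next
  fix X Y :: "real^'n^'n \<Rightarrow> real^'n^'n"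
  assume XY: "smooth_vector_field (Gr k) X \<and> smooth_vector_field (Gr k) Y"
  show "smooth_map_on (Gr k) (\<lambda>Q. gr_metric Q (X Q) (Y Q))"
    unfolding smooth_map_on_def
  proof
    fix Q :: "real^'n^'n" assume "Q \<in> Gr k"
    \<comment> \<open>The fields have smooth local extensions \<open>F\<close> and \<open>G\<close>
      on separate neighborhoods; on the intersection \<open>trace (F y ** G y)\<close> extends the
      metric value.\<close>
    then obtain U F V G where F: "Q \<in> U" "smooth_on U F" "\<forall>y\<in>Gr k \<inter> U. F y = X y"
      and G: "Q \<in> V" "smooth_on V G" "\<forall>y\<in>Gr k \<inter> V. G y = Y y"
      using XY unfolding smooth_vector_field_def smooth_map_on_def by metis
    have "open (U \<inter> V)"
      using F(2) G(2) by (auto simp: smooth_on_def)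
    moreover have "C_diff_on m (U \<inter> V) F" "C_diff_on m (U \<inter> V) G" for m
      using F(2) G(2) C_diff_on_subset unfolding smooth_on_def by (metis inf_le1, metis inf_le2)
    ultimately have "smooth_on (U \<inter> V) (\<lambda>y. trace (F y ** G y))"
      unfolding smooth_on_def
      by (auto intro!: C_diff_on_bounded_linear[OF bounded_linear_trace]
          C_diff_on_bounded_bilinear[OF bounded_bilinear_matrix_mult])
    then show "\<exists>U F. Q \<in> U \<and> smooth_on U F \<and>
        (\<forall>y\<in>Gr k \<inter> U. F y = gr_metric y (X y) (Y y))"
      using F G by (intro exI[of _ "U \<inter> V"] exI[of _ "\<lambda>y. trace (F y ** G y)"])
        (auto simp: gr_metric_def)
  qed
qed

section \<open>Block matrices\<close>

context
  fixes e :: "'n::finite \<Rightarrow> nat"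
  assumes e: "bij_betw e UNIV {..<CARD('n)}"
begin

lemma enum_less: "e i < CARD('n)"
  using e by (auto simp: bij_betw_def)

lemma to_hma_mult:
  assumes "A \<in> carrier_mat CARD('n) CARD('n)" "B \<in> carrier_mat CARD('n) CARD('n)"
  shows "to_hma e (A * B) = to_hma e A ** to_hma e B"
proof -
  have "(A * B) $$ (e i, e j) = (\<Sum>k\<in>UNIV. A $$ (e i, e k) * B $$ (e k, e j))" for i j
  proof -
    have "(A * B) $$ (e i, e j) = (\<Sum>l<CARD('n). A $$ (e i, l) * B $$ (l, e j))"
      using assms enum_less[of i] enum_less[of j]
      by (auto simp: scalar_prod_def atLeast0LessThan intro!: sum.cong)
    also have "\<dots> = (\<Sum>k\<in>UNIV. A $$ (e i, e k) * B $$ (e k, e j))"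
      by (rule sum.reindex_bij_betw[OF e, symmetric])
    finally show ?thesis .
  qed
  then show ?thesis
    by (simp add: to_hma_def matrix_matrix_mult_def)
qed

lemma trace_to_hma:
  assumes "A \<in> carrier_mat CARD('n) CARD('n)"
  shows "trace (to_hma e A) = mat_trace A"
  using assms sum.reindex_bij_betw[OF e, of "\<lambda>i. A $$ (i, i)"]
  by (simp add: trace_def to_hma_def mat_trace_def)

lemma transpose_to_hma:
  assumes "A \<in> carrier_mat CARD('n) CARD('n)"
  shows "transpose (to_hma e A) = to_hma e (transpose_mat A)"
  using assms enum_less by (simp add: transpose_def to_hma_def)

context
  fixes k :: nat
  assumes k: "k \<le> CARD('n)"
begin

lemma offdiag_mat_carrier:
  assumes "B \<in> carrier_mat k (CARD('n) - k)"
  shows "offdiag_mat B \<in> carrier_mat CARD('n) CARD('n)"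
proof -
  have "dim_row B = k" "dim_col B = CARD('n) - k"
    using assms by auto
  then have "offdiag_mat B \<in> carrier_mat (k + (CARD('n) - k)) (k + (CARD('n) - k))"
    unfolding offdiag_mat_def by (intro four_block_carrier_mat) simp_all
  then show ?thesis
    using k by simp
qed

lemma transpose_offdiag:
  assumes "B \<in> carrier_mat k (CARD('n) - k)"
  shows "transpose (to_hma e (offdiag_mat B)) = to_hma e (offdiag_mat B)"
proof -
  have "transpose_mat (offdiag_mat B) = offdiag_mat B"
    using assms unfolding offdiag_mat_def by (intro eq_matI) auto
  then show ?thesis
    by (simp add: transpose_to_hma[OF offdiag_mat_carrier[OF assms]])
qed

text \<open>Left multiplication by the signature matrix negates the lower rows, right multiplication
  the right columns; on matrices with only off-diagonal blocks the results are opposite.\<close>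

lemma signature_offdiag_anticommute:
  assumes B: "B \<in> carrier_mat k (CARD('n) - k)"
  shows "to_hma e (signature_mat k (CARD('n) - k)) ** to_hma e (offdiag_mat B) =
    - (to_hma e (offdiag_mat B) ** to_hma e (signature_mat k (CARD('n) - k)))"
proof -
  let ?m = "CARD('n) - k"
  have S: "signature_mat k ?m \<in> carrier_mat CARD('n) CARD('n)"
    using four_block_carrier_mat[of "1\<^sub>m k" k k "- 1\<^sub>m ?m" ?m ?m] k
    by (simp add: signature_mat_def)
  have dims: "dim_row B = k" "dim_col B = ?m"
    using B by auto
  have B': "transpose_mat B \<in> carrier_mat ?m k"
    using B by simp
  have "signature_mat k ?m * offdiag_mat B = four_block_mat (0\<^sub>m k k) B (- transpose_mat B) (0\<^sub>m ?m ?m)"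
    unfolding signature_mat_def offdiag_mat_def dims
    by (subst mult_four_block_mat[of _ k k _ ?m _ ?m _ _ k _ ?m]) (use B B' in auto)
  moreover have "offdiag_mat B * signature_mat k ?m = four_block_mat (0\<^sub>m k k) (- B) (transpose_mat B) (0\<^sub>m ?m ?m)"
    unfolding signature_mat_def offdiag_mat_def dims
    by (subst mult_four_block_mat[of _ k k _ ?m _ ?m _ _ k _ ?m]) (use B B' in auto)
  moreover have "to_hma e (four_block_mat (0\<^sub>m k k) B (- transpose_mat B) (0\<^sub>m ?m ?m)) =
      - to_hma e (four_block_mat (0\<^sub>m k k) (- B) (transpose_mat B) (0\<^sub>m ?m ?m))"
  proof -
    \<comment> \<open>Row and column indices in the later blocks are shifted by \<open>k\<close>;
      this bound keeps them in range, so entries of negated blocks can be unfolded.\<close>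
    have "e i - k < ?m" if "\<not> e i < k" for i
      using enum_less[of i] that by linarith
    then show ?thesis
      using B enum_less k by (auto simp: to_hma_def Finite_Cartesian_Product.vec_eq_iff)
  qed
  ultimately show ?thesis
    by (simp add: to_hma_mult[symmetric] S offdiag_mat_carrier[OF B])
qed

text \<open>The product is block diagonal with blocks \<open>B * transpose_mat C\<close> and
  \<open>transpose_mat B * C\<close>. Both have as trace the sum of the entrywise products of
  \<open>B\<close> and \<open>C\<close>, whence the factor 2.\<close>

lemma trace_offdiag_mult:
  assumes B: "B \<in> carrier_mat k (CARD('n) - k)" and C: "C \<in> carrier_mat k (CARD('n) - k)"
  shows "trace (to_hma e (offdiag_mat B) ** to_hma e (offdiag_mat C)) = 2 * mat_trace (transpose_mat B * C)"
proof -
  let ?m = "CARD('n) - k"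
  have dims: "dim_row B = k" "dim_col B = ?m" "dim_row C = k" "dim_col C = ?m"
    using B C by auto
  have "offdiag_mat B * offdiag_mat C =
      four_block_mat (B * transpose_mat C) (0\<^sub>m k ?m) (0\<^sub>m ?m k) (transpose_mat B * C)"
    unfolding offdiag_mat_def dims
    by (subst mult_four_block_mat[of _ k k _ ?m _ ?m _ _ k _ ?m]) (use B C in auto)
  moreover have "mat_trace (four_block_mat (B * transpose_mat C) (0\<^sub>m k ?m) (0\<^sub>m ?m k) (transpose_mat B * C))
      = mat_trace (B * transpose_mat C) + mat_trace (transpose_mat B * C)"
  proof -
    have "(\<Sum>i<k + m. f i) = (\<Sum>i<k. f i) + (\<Sum>i<m. f (k + i))" for f :: "nat \<Rightarrow> real" and m
      by (induction m) simp_all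
    from this[where m = ?m] show ?thesis
      \<comment> \<open>The sum \<open>k + (CARD('n) - k)\<close> must stay unsimplified for the
        range to split at \<open>k\<close>.\<close>
      using B C by (simp add: mat_trace_def del: le_add_diff_inverse)
  qed
  moreover have "mat_trace (B * transpose_mat C) = (\<Sum>i<k. \<Sum>j<?m. B $$ (i, j) * C $$ (i, j))"
    using B C by (simp add: mat_trace_def scalar_prod_def atLeast0LessThan)
  moreover have "mat_trace (transpose_mat B * C) = (\<Sum>j<?m. \<Sum>i<k. B $$ (i, j) * C $$ (i, j))"
    using B C by (simp add: mat_trace_def scalar_prod_def atLeast0LessThan)
  moreover have "(\<Sum>i<k. \<Sum>j<?m. B $$ (i, j) * C $$ (i, j)) = (\<Sum>j<?m. \<Sum>i<k. B $$ (i, j) * C $$ (i, j))"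
    by (rule sum.swap)
  moreover have "trace (to_hma e (offdiag_mat B) ** to_hma e (offdiag_mat C)) = mat_trace (offdiag_mat B * offdiag_mat C)"
    using offdiag_mat_carrier[OF B] offdiag_mat_carrier[OF C]
    by (simp add: to_hma_mult[symmetric] trace_to_hma)
  ultimately show ?thesis by simp
qed

end

end

lemma mat_trace_transpose_mult: "mat_trace (transpose_mat B * B) = (mat_frobenius B)\<^sup>2"
proof -
  have "mat_trace (transpose_mat B * B) = (\<Sum>j<dim_col B. \<Sum>i<dim_row B. (B $$ (i, j))\<^sup>2)"
    by (simp add: mat_trace_def scalar_prod_def atLeast0LessThan power2_eq_square)
  also have "\<dots> = (\<Sum>i<dim_row B. \<Sum>j<dim_col B. (B $$ (i, j))\<^sup>2)"
    by (rule sum.swap)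
  finally show ?thesis
    by (simp add: mat_frobenius_def sum_nonneg)
qed

lemma frobenius_eq: "frobenius A = sqrt (trace (transpose A ** A))"
  by (simp add: frobenius_def inner_eq_trace[symmetric] inner_vec_def power2_eq_square)

theorem proposition3p4:
  fixes k :: nat and e :: "'n::finite \<Rightarrow> nat"
  assumes "bij_betw e UNIV {..<CARD('n)}" and "1 \<le> k" and "k \<le> CARD('n)"
  shows "riemannian_metric (Gr k :: (real^'n^'n) set) gr_metric \<and>
    (\<forall>(Q :: real^'n^'n) V B C X Y.
       Q \<in> Gr k \<and> orthogonal_matrix V \<and>
       Q = V ** to_hma e (signature_mat k (CARD('n) - k)) ** transpose V \<and>
       B \<in> carrier_mat k (CARD('n) - k) \<and> C \<in> carrier_mat k (CARD('n) - k) \<and>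
       X = V ** to_hma e (offdiag_mat B) ** transpose V \<and>
       Y = V ** to_hma e (offdiag_mat C) ** transpose V \<longrightarrow>
         X \<in> tangent_space (Gr k) Q \<and> Y \<in> tangent_space (Gr k) Q \<and>
         gr_metric Q X Y = trace (X ** Y) \<and>
         gr_metric Q X Y = 2 * mat_trace (transpose_mat B * C) \<and>
         riemannian_norm gr_metric Q X = sqrt (gr_metric Q X X) \<and>
         riemannian_norm gr_metric Q X = frobenius X \<and>
         riemannian_norm gr_metric Q X = sqrt 2 * mat_frobenius B)"
proof (intro conjI allI impI)
  show "riemannian_metric (Gr k :: (real^'n^'n) set) gr_metric"
    by (rule riemannian_metric_Gr[OF assms(3)])
next
  fix Q V :: "real^'n^'n" and B C X Y
  let ?J = "to_hma e (signature_mat k (CARD('n) - k))"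
  let ?lift = "\<lambda>B. V ** to_hma e (offdiag_mat B) ** transpose V"
  assume H: "Q \<in> Gr k \<and> orthogonal_matrix V \<and> Q = V ** ?J ** transpose V \<and>
       B \<in> carrier_mat k (CARD('n) - k) \<and> C \<in> carrier_mat k (CARD('n) - k) \<and>
       X = ?lift B \<and> Y = ?lift C"
  then have Q: "Q \<in> Gr k" "Q = V ** ?J ** transpose V"
    and B: "B \<in> carrier_mat k (CARD('n) - k)" and C: "C \<in> carrier_mat k (CARD('n) - k)"
    and X: "X = ?lift B" and Y: "Y = ?lift C"
    and V: "transpose V ** V = mat 1"
    by (auto simp: orthogonal_matrix_def)
  have V': "transpose V ** (V ** Z) = Z" for Z
    by (simp add: matrix_mul_assoc V)
  have sym: "transpose (?lift D) = ?lift D" if "D \<in> carrier_mat k (CARD('n) - k)" for D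
    by (simp add: matrix_transpose_mul transpose_offdiag[OF assms(1,3) that] matrix_mul_assoc)
  have tangent: "?lift D \<in> tangent_space (Gr k) Q" if D: "D \<in> carrier_mat k (CARD('n) - k)" for D
  proof -
    \<comment> \<open>The inner factors \<open>transpose V ** V\<close> cancel, so tangency reduces
      to anticommutation of the block matrices.\<close>
    have "Q ** ?lift D + ?lift D ** Q = V ** (?J ** to_hma e (offdiag_mat D)
        + to_hma e (offdiag_mat D) ** ?J) ** transpose V"
      by (simp add: Q(2) matrix_ring_simps V')
    then have "Q ** ?lift D + ?lift D ** Q = 0"
      by (simp add: signature_offdiag_anticommute[OF assms(1,3) D])
    then show ?thesis
      using sym[OF D] by (simp add: tangent_space_Gr[OF Q(1)])
  qed
  have metric: "gr_metric Q (?lift D) (?lift E) = 2 * mat_trace (transpose_mat D * E)"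
    if D: "D \<in> carrier_mat k (CARD('n) - k)" and E: "E \<in> carrier_mat k (CARD('n) - k)" for D E
  proof -
    let ?M = "to_hma e (offdiag_mat D) ** to_hma e (offdiag_mat E)"
    have "gr_metric Q (?lift D) (?lift E) = trace (V ** (?M ** transpose V))"
      by (simp add: gr_metric_def matrix_ring_simps V')
    also have "\<dots> = trace ?M"
      by (subst trace_mul_sym) (simp add: V flip: matrix_mul_assoc)
    finally show ?thesis
      by (simp add: trace_offdiag_mult[OF assms(1,3) D E])
  qed
  show "X \<in> tangent_space (Gr k) Q" "Y \<in> tangent_space (Gr k) Q"
    unfolding X Y by (rule tangent[OF B], rule tangent[OF C])
  show "gr_metric Q X Y = trace (X ** Y)"
    by (simp add: gr_metric_def)
  show "gr_metric Q X Y = 2 * mat_trace (transpose_mat B * C)"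
    unfolding X Y by (rule metric[OF B C])
  show "riemannian_norm gr_metric Q X = sqrt (gr_metric Q X X)"
    by (simp add: riemannian_norm_def)
  show "riemannian_norm gr_metric Q X = frobenius X"
    using sym[OF B] by (simp add: riemannian_norm_def gr_metric_def frobenius_eq X)
  \<comment> \<open>Nonnegativity lets the square root undo the square of
    \<open>mat_frobenius B\<close>.\<close>
  have "mat_frobenius B \<ge> 0"
    by (simp add: mat_frobenius_def sum_nonneg)
  then show "riemannian_norm gr_metric Q X = sqrt 2 * mat_frobenius B"
    unfolding riemannian_norm_def X metric[OF B B] mat_trace_transpose_mult
    by (simp add: real_sqrt_mult)
qed

end
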